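(* Let $\Lambda$ be a compact approximate subgroup of a Hausdorff topological group $G$ and let $\Gamma$ be a subgroup of $G$ that contains $\Lambda$ and commensurates it. There are a locally compact group $H$, an injective continuous group homomorphism $\phi:H\to G$ and a compact symmetric neighbourhood of the identity $V\subset H$ that generates $H$ such that $\phi(V)=\Lambda^2$ and $\phi(H)=\Gamma$.
   Context: An approximate subgroup of a group $G$ is a subset $\Lambda \subset G$ with $\Lambda=\Lambda^{-1}$, $e\in\Lambda$, and $\Lambda\Lambda\subset F\Lambda$ for some finite $F\subset G$. $\Lambda^2=\{\lambda_1\lambda_2:\lambda_1,\lambda_2\in\Lambda\}$. Subsets $X,Y\subset G$ are commensurable if there is a finite $F\subset G$ with $X\subset FY$ and $Y\subset FX$. The subgroup $\Gamma$ commensurates $\Lambda$ if $\gamma\Lambda\gamma^{-1}$ is commensurable to $\Lambda$ for every $\gamma\in\Gamma$.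
   Formalization: That V generates H is claimed only when Λ generates Γ; otherwise it contradicts φ(V)=Λ² and φ(H)=Γ (e.g. G=Γ=ℤ discrete, Λ={0}). All other conclusions are proved for arbitrary Γ. *)

theory Defs
  imports "HOL-Analysis.Analysis" "HOL-Algebra.Generated_Groups"
begin

locale topological_group = group G for G (structure) +
  fixes T :: "'a topology"
  assumes topspace_eq: "topspace T = carrier G"
    and continuous_mult: "continuous_map (prod_topology T T) T (\<lambda>(x, y). x \<otimes> y)"
    and continuous_inv: "continuous_map T T (\<lambda>x. inv x)"

(* Locally compact groups are Hausdorff by convention. *)
locale locally_compact_group = topological_group +
  assumes Hausdorff: "Hausdorff_space T"
    and locally_compact: "locally_compact_space T"

definition approximate_subgroup :: "('a, 'b) monoid_scheme \<Rightarrow> 'a set \<Rightarrow> bool" where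
  "approximate_subgroup G \<Lambda> \<longleftrightarrow>
     \<Lambda> \<subseteq> carrier G \<and> set_inv\<^bsub>G\<^esub> \<Lambda> = \<Lambda> \<and> \<one>\<^bsub>G\<^esub> \<in> \<Lambda> \<and>
     (\<exists>F. finite F \<and> F \<subseteq> carrier G \<and> \<Lambda> <#>\<^bsub>G\<^esub> \<Lambda> \<subseteq> F <#>\<^bsub>G\<^esub> \<Lambda>)"

definition commensurable :: "('a, 'b) monoid_scheme \<Rightarrow> 'a set \<Rightarrow> 'a set \<Rightarrow> bool" where
  "commensurable G X Y \<longleftrightarrow>
     (\<exists>F. finite F \<and> F \<subseteq> carrier G \<and> X \<subseteq> F <#>\<^bsub>G\<^esub> Y \<and> Y \<subseteq> F <#>\<^bsub>G\<^esub> X)"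

definition commensurates :: "('a, 'b) monoid_scheme \<Rightarrow> 'a set \<Rightarrow> 'a set \<Rightarrow> bool" where
  "commensurates G \<Gamma> \<Lambda> \<longleftrightarrow>
     (\<forall>\<gamma>\<in>\<Gamma>. commensurable G ((\<gamma> <#\<^bsub>G\<^esub> \<Lambda>) #>\<^bsub>G\<^esub> inv\<^bsub>G\<^esub> \<gamma>) \<Lambda>)"

(* Neighbourhoods need not be open. *)
definition symmetric_identity_nhd ::
    "('a, 'b) monoid_scheme \<Rightarrow> 'a topology \<Rightarrow> 'a set \<Rightarrow> bool" where
  "symmetric_identity_nhd G T V \<longleftrightarrow>
     V \<subseteq> carrier G \<and> set_inv\<^bsub>G\<^esub> V = V \<and> (\<exists>U. openin T U \<and> \<one>\<^bsub>G\<^esub> \<in> U \<and> U \<subseteq> V)"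

(* If a homomorphism maps V onto the square of L and V generates its domain, then its image is
   the subgroup generated by L. Hence, when the image is to be all of a subgroup containing L,
   V can generate the domain only if L generates that subgroup. *)
lemma image_eq_generate_if_generating:
  assumes G: "group G" and H: "group H" and hom: "\<phi> \<in> hom H G"
    and L: "L \<subseteq> carrier G" "\<one>\<^bsub>G\<^esub> \<in> L"
    and V: "V \<subseteq> carrier H" "generate H V = carrier H" "\<phi> ` V = L <#>\<^bsub>G\<^esub> L"
  shows "\<phi> ` carrier H = generate G L"
proof -
  interpret grp: group G by (rule G)
  interpret group_hom H G \<phi>
    using G H hom by (simp add: group_hom_def group_hom_axioms_def)
  have sub: "subgroup (generate G L) G"
    using L(1) by (rule grp.generate_is_subgroup)
  have "L \<subseteq> L <#>\<^bsub>G\<^esub> L"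
    using L unfolding set_mult_def by force
  moreover have "L <#>\<^bsub>G\<^esub> L \<subseteq> generate G L"
    unfolding set_mult_def by (auto intro: generate.eng generate.incl)
  moreover have LL: "L <#>\<^bsub>G\<^esub> L \<subseteq> carrier G"
    using L(1) by (intro grp.set_mult_closed)
  ultimately have "generate G (L <#>\<^bsub>G\<^esub> L) = generate G L"
    by (meson grp.generate_subgroup_incl grp.mono_generate sub subset_antisym)
  then show ?thesis
    using generate_img[OF V(1)] V by simp
qed

end

theory Submission
  imports Defs
begin

text \<open>
  The topology on \<open>\<Gamma>\<close> has the traces \<open>N \<inter> \<Lambda>\<^sup>2\<close> of the identity neighbourhoods \<open>N\<close> of \<open>G\<close> as a
  neighbourhood base at the identity. The axioms of a group topology all reduce to one observation:
  if \<open>X\<close> is covered by finitely many translates \<open>f\<Lambda>\<close>, then \<open>N \<inter> X \<subseteq> \<Lambda>\<^sup>2\<close> for some \<open>N\<close>. Indeed the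
  translates are closed, so those missing the identity can be avoided, and \<open>f\<Lambda>\<close> contains the identity
  only if \<open>f \<in> \<Lambda>\<close>. This is applied to \<open>X = \<Lambda>\<^sup>4\<close> for multiplication, to the conjugates of
  \<open>\<Lambda>\<^sup>2\<close> for conjugation, and to \<open>X = x\<inverse>\<Lambda>\<^sup>2\<close> to see that the new topology agrees with the old one
  on \<open>\<Lambda>\<^sup>2\<close>, which therefore remains compact.
\<close>

section \<open>Group topologies defined by a neighbourhood base at the identity\<close>

locale identity_base = group G for G (structure) +
  fixes \<B> :: "'a set set"
  assumes base_nonempty: "\<B> \<noteq> {}"
    and base_carrier: "A \<in> \<B> \<Longrightarrow> A \<subseteq> carrier G"
    and base_one: "A \<in> \<B> \<Longrightarrow> \<one> \<in> A"
    and base_Int: "A \<in> \<B> \<Longrightarrow> B \<in> \<B> \<Longrightarrow> \<exists>C\<in>\<B>. C \<subseteq> A \<inter> B"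
    and base_mult: "A \<in> \<B> \<Longrightarrow> \<exists>B\<in>\<B>. \<forall>x\<in>B. \<forall>y\<in>B. x \<otimes> y \<in> A"
    and base_inv: "A \<in> \<B> \<Longrightarrow> \<exists>B\<in>\<B>. \<forall>x\<in>B. inv x \<in> A"
    and base_conj: "A \<in> \<B> \<Longrightarrow> g \<in> carrier G \<Longrightarrow> \<exists>B\<in>\<B>. \<forall>x\<in>B. g \<otimes> x \<otimes> inv g \<in> A"
begin

text \<open>Members of \<B> need not be open, so openness is tested by left translates xA around
  each point. By \<open>base_conj\<close>, right translates would give the same topology.\<close>

definition base_topology :: "'a topology" where
  "base_topology =
     topology (\<lambda>U. U \<subseteq> carrier G \<and> (\<forall>x\<in>U. \<exists>A\<in>\<B>. \<forall>a\<in>A. x \<otimes> a \<in> U))"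

lemma openin_base_topology:
  "openin base_topology U \<longleftrightarrow> U \<subseteq> carrier G \<and> (\<forall>x\<in>U. \<exists>A\<in>\<B>. \<forall>a\<in>A. x \<otimes> a \<in> U)"
proof -
  let ?P = "\<lambda>U. U \<subseteq> carrier G \<and> (\<forall>x\<in>U. \<exists>A\<in>\<B>. \<forall>a\<in>A. x \<otimes> a \<in> U)"
  have "istopology ?P"
    unfolding istopology_def
  proof (intro conjI allI impI)
    fix U W assume U: "?P U" and W: "?P W"
    show "\<forall>x\<in>U \<inter> W. \<exists>A\<in>\<B>. \<forall>a\<in>A. x \<otimes> a \<in> U \<inter> W"
    proof
      fix x assume "x \<in> U \<inter> W"
      then obtain A B where "A \<in> \<B>" "B \<in> \<B>" "\<forall>a\<in>A. x \<otimes> a \<in> U" "\<forall>a\<in>B. x \<otimes> a \<in> W"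
        using U W by blast
      with base_Int[of A B] show "\<exists>A\<in>\<B>. \<forall>a\<in>A. x \<otimes> a \<in> U \<inter> W"
        by (metis Int_iff subsetD)
    qed
    show "U \<inter> W \<subseteq> carrier G"
      using U by blast
  next
    fix \<U> assume "\<forall>U\<in>\<U>. ?P U"
    then show "\<Union>\<U> \<subseteq> carrier G" "\<forall>x\<in>\<Union>\<U>. \<exists>A\<in>\<B>. \<forall>a\<in>A. x \<otimes> a \<in> \<Union>\<U>"
      by (blast, metis Union_iff)
  qed
  then show ?thesis
    unfolding base_topology_def by (simp add: topology_inverse')
qed

lemma topspace_base_topology [simp]: "topspace base_topology = carrier G"
proof
  show "topspace base_topology \<subseteq> carrier G"
    using openin_topspace openin_base_topology by blast
  have "openin base_topology (carrier G)"
    unfolding openin_base_topology using base_nonempty base_carrier by (meson ex_in_conv m_closed subset_iff)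
  then show "carrier G \<subseteq> topspace base_topology"
    by (rule openin_subset)
qed

text \<open>The translate xA may fail to be open, but its interior, the set of u with uC \<subseteq>
  xA for some C in \<B>, is open: \<open>base_mult\<close> gives D with DD \<subseteq> C, so (ud)D
  \<subseteq> xA for every d in D.\<close>

lemma base_nhd:
  assumes "A \<in> \<B>" "x \<in> carrier G"
  obtains U where "openin base_topology U" "x \<in> U" "\<And>u. u \<in> U \<Longrightarrow> \<exists>a\<in>A. u = x \<otimes> a"
proof -
  let ?U = "{u \<in> carrier G. \<exists>C\<in>\<B>. \<forall>c\<in>C. \<exists>a\<in>A. u \<otimes> c = x \<otimes> a}"
  have "\<exists>D\<in>\<B>. \<forall>d\<in>D. u \<otimes> d \<in> ?U" if u: "u \<in> ?U" for u
  proof -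
    obtain C where C: "C \<in> \<B>" "\<forall>c\<in>C. \<exists>a\<in>A. u \<otimes> c = x \<otimes> a"
      using u by blast
    obtain D where D: "D \<in> \<B>" "\<forall>d\<in>D. \<forall>d'\<in>D. d \<otimes> d' \<in> C"
      using base_mult C(1) by blast
    have "u \<otimes> d \<in> ?U" if d: "d \<in> D" for d
    proof -
      have "u \<otimes> d \<otimes> d' = u \<otimes> (d \<otimes> d')" if "d' \<in> D" for d'
        using u d that base_carrier[OF D(1)] by (auto intro!: m_assoc)
      then have "\<forall>d'\<in>D. \<exists>a\<in>A. u \<otimes> d \<otimes> d' = x \<otimes> a"
        using C(2) D(2) d by simp
      then show ?thesis
        using u d D(1) base_carrier[OF D(1)] by blast
    qed
    then show ?thesis
      using D(1) by blast
  qed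
  then have "openin base_topology ?U"
    unfolding openin_base_topology by blast
  moreover have "x \<in> ?U"
    using assms by blast
  \<comment> \<open>Take c = \<one>, which lies in every member of \<B>.\<close>
  moreover have "\<exists>a\<in>A. u = x \<otimes> a" if "u \<in> ?U" for u
    using that base_one by (auto dest!: bspec[where x = \<one>])
  ultimately show ?thesis
    using that by blast
qed

lemma continuous_mult_base_topology:
  "continuous_map (prod_topology base_topology base_topology) base_topology (\<lambda>(x, y). x \<otimes> y)"
  unfolding continuous_map
proof (intro conjI allI impI)
  show "(\<lambda>(x, y). x \<otimes> y) ` topspace (prod_topology base_topology base_topology)
      \<subseteq> topspace base_topology"
    by auto
next
  fix W assume W: "openin base_topology W"
  let ?P = "{p \<in> topspace (prod_topology base_topology base_topology). (case p of (x, y) \<Rightarrow> x \<otimes> y) \<in> W}"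
  show "openin (prod_topology base_topology base_topology) ?P"
    unfolding openin_prod_topology_alt
  proof (intro allI impI)
    fix x y assume "(x, y) \<in> ?P"
    then have x: "x \<in> carrier G" and y: "y \<in> carrier G" and xy: "x \<otimes> y \<in> W"
      by auto
    obtain A where A: "A \<in> \<B>" "\<forall>a\<in>A. x \<otimes> y \<otimes> a \<in> W"
      using W xy unfolding openin_base_topology by blast
    obtain B where B: "B \<in> \<B>" "\<forall>b\<in>B. \<forall>c\<in>B. b \<otimes> c \<in> A"
      using base_mult A(1) by blast
    \<comment> \<open>The perturbation c of x has to be moved past y: (xc)(yb) =
      xy((\<open>inv y\<close> c y)b).\<close>
    obtain C where C: "C \<in> \<B>" "\<forall>c\<in>C. inv y \<otimes> c \<otimes> inv (inv y) \<in> B"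
      using base_conj[OF B(1), of "inv y"] y by blast
    obtain U where U: "openin base_topology U" "x \<in> U" "\<And>u. u \<in> U \<Longrightarrow> \<exists>c\<in>C. u = x \<otimes> c"
      using base_nhd[OF C(1) x] by blast
    obtain V where V: "openin base_topology V" "y \<in> V" "\<And>v. v \<in> V \<Longrightarrow> \<exists>b\<in>B. v = y \<otimes> b"
      using base_nhd[OF B(1) y] by blast
    have "u \<otimes> v \<in> W" if uv: "u \<in> U" "v \<in> V" for u v
    proof -
      obtain b c where b: "b \<in> B" "v = y \<otimes> b" and c: "c \<in> C" "u = x \<otimes> c"
        using U(3) V(3) uv by blast
      have cl: "b \<in> carrier G" "c \<in> carrier G"
        using b c B(1) C(1) base_carrier by auto
      have "u \<otimes> v = x \<otimes> y \<otimes> ((inv y \<otimes> c \<otimes> inv (inv y)) \<otimes> b)"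
        using b c cl x y by (simp add: m_assoc) (simp add: m_assoc[symmetric])
      then show ?thesis
        using A(2) B(2) C(2) b(1) c(1) by simp
    qed
    then have "U \<times> V \<subseteq> ?P"
      using U(1) V(1) openin_subset by fastforce
    then show "\<exists>U V. openin base_topology U \<and> openin base_topology V \<and> x \<in> U \<and> y \<in> V \<and> U \<times> V \<subseteq> ?P"
      using U V by blast
  qed
qed

lemma continuous_inv_base_topology: "continuous_map base_topology base_topology (\<lambda>x. inv x)"
  unfolding continuous_map
proof (intro conjI allI impI)
  show "(\<lambda>x. inv x) ` topspace base_topology \<subseteq> topspace base_topology"
    by auto
next
  fix W assume W: "openin base_topology W"
  show "openin base_topology {x \<in> topspace base_topology. inv x \<in> W}"
    unfolding openin_base_topology
  proof (intro conjI ballI)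
    fix x assume "x \<in> {x \<in> topspace base_topology. inv x \<in> W}"
    then have x: "x \<in> carrier G" "inv x \<in> W"
      by auto
    obtain A where A: "A \<in> \<B>" "\<forall>a\<in>A. inv x \<otimes> a \<in> W"
      using W x unfolding openin_base_topology by blast
    \<comment> \<open>Inversion reverses the order of x and c; conjugation restores it, since
      \<open>inv (x \<otimes> c)\<close> = \<open>inv x\<close>(x \<open>inv c\<close>
      \<open>inv x\<close>).\<close>
    obtain B where B: "B \<in> \<B>" "\<forall>b\<in>B. x \<otimes> b \<otimes> inv x \<in> A"
      using base_conj[OF A(1)] x by blast
    obtain C where C: "C \<in> \<B>" "\<forall>c\<in>C. inv c \<in> B"
      using base_inv[OF B(1)] by blast
    have "inv (x \<otimes> c) \<in> W" if "c \<in> C" for c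
    proof -
      have "c \<in> carrier G"
        using that base_carrier[OF C(1)] by blast
      then have "inv (x \<otimes> c) = inv x \<otimes> (x \<otimes> inv c \<otimes> inv x)"
        using x by (simp add: inv_mult_group m_assoc[symmetric])
      then show ?thesis
        using A(2) B(2) C(2) that by simp
    qed
    then show "\<exists>A\<in>\<B>. \<forall>a\<in>A. x \<otimes> a \<in> {x \<in> topspace base_topology. inv x \<in> W}"
      using C(1) x base_carrier[OF C(1)] by (intro bexI[OF _ C(1)]) auto
  qed auto
qed

lemma topological_group_base_topology: "topological_group G base_topology"
  by unfold_locales
    (simp_all add: continuous_mult_base_topology continuous_inv_base_topology)

end

section \<open>Translations, compact sets and identity neighbourhoods in topological groups\<close>

lemma finite_set_mult: "finite A \<Longrightarrow> finite B \<Longrightarrow> finite (A <#>\<^bsub>G\<^esub> B)"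
  by (simp add: set_mult_def)

context topological_group
begin

lemma continuous_map_mult_left:
  assumes "a \<in> carrier G"
  shows "continuous_map T T (\<lambda>x. a \<otimes> x)"
proof -
  have "continuous_map T (prod_topology T T) (\<lambda>x. (a, x))"
    using assms by (simp add: continuous_map_pairwise o_def topspace_eq)
  from continuous_map_compose[OF this continuous_mult] show ?thesis
    by (simp add: o_def)
qed

lemma continuous_map_mult_right:
  assumes "a \<in> carrier G"
  shows "continuous_map T T (\<lambda>x. x \<otimes> a)"
proof -
  have "continuous_map T (prod_topology T T) (\<lambda>x. (x, a))"
    using assms by (simp add: continuous_map_pairwise o_def topspace_eq)
  from continuous_map_compose[OF this continuous_mult] show ?thesis
    by (simp add: o_def)
qed

lemma openin_mult_left_preimage:
  assumes "a \<in> carrier G" "openin T U"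
  shows "openin T {x \<in> carrier G. a \<otimes> x \<in> U}"
  using openin_continuous_map_preimage[OF continuous_map_mult_left assms(2)] assms(1)
  by (simp add: topspace_eq)

lemma compactin_set_mult:
  assumes "compactin T A" "compactin T B"
  shows "compactin T (A <#> B)"
proof -
  have "A <#> B = (\<lambda>(x, y). x \<otimes> y) ` (A \<times> B)"
    by (auto simp: set_mult_def)
  then show ?thesis
    using image_compactin[OF _ continuous_mult, of "A \<times> B"] assms by (simp add: compactin_Times)
qed

text \<open>Left translation by x carries the compact neighbourhood K of \<one> to one of x.\<close>

lemma locally_compact_if_compact_nhd:
  assumes "compactin T K" "openin T U" "\<one> \<in> U" "U \<subseteq> K"
  shows "locally_compact_space T"
  unfolding locally_compact_space_def
proof
  fix x assume "x \<in> topspace T"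
  then have x: "x \<in> carrier G"
    by (simp add: topspace_eq)
  let ?U = "{y \<in> carrier G. inv x \<otimes> y \<in> U}"
  have "?U \<subseteq> (\<lambda>y. x \<otimes> y) ` K"
  proof
    fix y assume "y \<in> ?U"
    then have "inv x \<otimes> y \<in> K" "y = x \<otimes> (inv x \<otimes> y)"
      using x assms(4) by (auto simp: m_assoc[symmetric])
    then show "y \<in> (\<lambda>y. x \<otimes> y) ` K"
      by blast
  qed
  moreover have "compactin T ((\<lambda>y. x \<otimes> y) ` K)"
    using image_compactin[OF assms(1) continuous_map_mult_left[OF x]] .
  ultimately show "\<exists>U K. openin T U \<and> compactin T K \<and> x \<in> U \<and> U \<subseteq> K"
    using openin_mult_left_preimage[OF inv_closed[OF x] assms(2)] x assms(3) by fastforce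
qed

lemma nhd_one_mult:
  assumes "openin T U" "\<one> \<in> U"
  obtains N where "openin T N" "\<one> \<in> N" "\<And>x y. x \<in> N \<Longrightarrow> y \<in> N \<Longrightarrow> x \<otimes> y \<in> U"
proof -
  let ?P = "{p \<in> topspace (prod_topology T T). (case p of (x, y) \<Rightarrow> x \<otimes> y) \<in> U}"
  have "openin (prod_topology T T) ?P"
    using openin_continuous_map_preimage[OF continuous_mult assms(1)] .
  moreover have "(\<one>, \<one>) \<in> ?P"
    using assms(2) by (simp add: topspace_eq)
  ultimately have "\<exists>A B. openin T A \<and> openin T B \<and> \<one> \<in> A \<and> \<one> \<in> B \<and> A \<times> B \<subseteq> ?P"
    by (rule openin_prod_topology_alt[THEN iffD1, rule_format])
  then obtain A B where "openin T A" "openin T B" "\<one> \<in> A" "\<one> \<in> B" "A \<times> B \<subseteq> ?P"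
    by (elim exE conjE)
  then show ?thesis
    by (intro that[of "A \<inter> B"]) auto
qed

lemma nhd_one_Int_finite_translates:
  assumes "Hausdorff_space T" "compactin T L" "set_inv L = L"
    and F: "finite F" "F \<subseteq> carrier G" and X: "X \<subseteq> F <#> L"
  obtains N where "openin T N" "\<one> \<in> N" "N \<inter> X \<subseteq> L <#> L"
proof -
  have L: "L \<subseteq> carrier G"
    using compactin_subset_topspace[OF assms(2)] by (simp add: topspace_eq)
  let ?E = "{f \<in> F. \<one> \<notin> (\<lambda>x. f \<otimes> x) ` L}"
  let ?N = "topspace T - (\<Union>f\<in>?E. (\<lambda>x. f \<otimes> x) ` L)"
  have "closedin T ((\<lambda>x. f \<otimes> x) ` L)" if "f \<in> F" for f
    using that F(2) assms(1,2)
    by (blast intro: compactin_imp_closedin image_compactin continuous_map_mult_left)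
  then have "openin T ?N"
    using F(1) by (intro openin_diff closedin_Union) auto
  moreover have "\<one> \<in> ?N"
    by (auto simp: topspace_eq)
  moreover have "?N \<inter> X \<subseteq> L <#> L"
  proof
    fix x assume x: "x \<in> ?N \<inter> X"
    then obtain f l where f: "f \<in> F" "l \<in> L" "x = f \<otimes> l"
      using X by (auto simp: set_mult_def)
    \<comment> \<open>The translates in \<open>?E\<close> have been removed and x lies in fL, so f
      is not in \<open>?E\<close>. From fk = \<one> with k in L, the symmetry of L then gives f
      \<in> L.\<close>
    then have "\<one> \<in> (\<lambda>x. f \<otimes> x) ` L"
      using x by blast
    then obtain k where k: "k \<in> L" "f \<otimes> k = \<one>"
      by auto
    then have "f = inv k"
      using F(2) L f(1) by (metis inv_equality subsetD)
    then have "f \<in> L"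
      using k(1) assms(3) by (auto simp: SET_INV_def)
    then show "x \<in> L <#> L"
      using f by (auto simp: set_mult_def)
  qed
  ultimately show ?thesis
    using that by blast
qed

end

section \<open>Sets covered by finitely many translates of \<Lambda>\<close>

locale commensurated_approximate_subgroup = topological_group +
  fixes \<Lambda> \<Gamma> :: "'a set"
  assumes Hausdorff: "Hausdorff_space T"
    and is_approximate: "approximate_subgroup G \<Lambda>"
    and compact: "compactin T \<Lambda>"
    and subgroup: "subgroup \<Gamma> G"
    and Lambda_subset: "\<Lambda> \<subseteq> \<Gamma>"
    and commensurates: "commensurates G \<Gamma> \<Lambda>"
begin

text \<open>The half of commensurability with \<Lambda> that bounds X from above; it is the
  condition on X in \<open>nhd_one_Int_finite_translates\<close>.\<close>

definition covered :: "'a set \<Rightarrow> bool" where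
  "covered X \<longleftrightarrow> (\<exists>F. finite F \<and> F \<subseteq> carrier G \<and> X \<subseteq> F <#> \<Lambda>)"

lemma Gamma_carrier: "\<Gamma> \<subseteq> carrier G"
  using subgroup by (rule subgroup.subset)

lemma Lambda_carrier: "\<Lambda> \<subseteq> carrier G"
  using is_approximate unfolding approximate_subgroup_def by blast

lemma Lambda_one: "\<one> \<in> \<Lambda>"
  using is_approximate unfolding approximate_subgroup_def by blast

lemma Lambda_set_inv: "set_inv \<Lambda> = \<Lambda>"
  using is_approximate unfolding approximate_subgroup_def by blast

lemma Lambda_inv: "x \<in> \<Lambda> \<Longrightarrow> inv x \<in> \<Lambda>"
  using Lambda_set_inv unfolding SET_INV_def by blast

lemma square_Gamma: "\<Lambda> <#> \<Lambda> \<subseteq> \<Gamma>"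
  using Lambda_subset subgroup.m_closed[OF subgroup] by (auto simp: set_mult_def)

lemma square_one: "\<one> \<in> \<Lambda> <#> \<Lambda>"
  using Lambda_one by (force simp: set_mult_def)

lemma square_inv:
  assumes "x \<in> \<Lambda> <#> \<Lambda>"
  shows "inv x \<in> \<Lambda> <#> \<Lambda>"
proof -
  obtain a b where ab: "a \<in> \<Lambda>" "b \<in> \<Lambda>" "x = a \<otimes> b"
    using assms by (auto simp: set_mult_def)
  then have "inv x = inv b \<otimes> inv a"
    using Lambda_carrier by (auto intro: inv_mult_group)
  then show ?thesis
    using ab Lambda_inv by (auto simp: set_mult_def)
qed

lemma covered_square: "covered (\<Lambda> <#> \<Lambda>)"
  using is_approximate unfolding covered_def approximate_subgroup_def by blast

text \<open>The approximate subgroup property absorbs the extra factor: X\<Lambda> \<subseteq>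
  E\<Lambda>\<Lambda> \<subseteq> EF\<Lambda>. Iterating this covers the higher powers of
  \<Lambda>.\<close>

lemma covered_set_mult:
  assumes "covered X"
  shows "covered (X <#> \<Lambda>)"
proof -
  obtain E F where E: "finite E" "E \<subseteq> carrier G" "X \<subseteq> E <#> \<Lambda>"
    and F: "finite F" "F \<subseteq> carrier G" "\<Lambda> <#> \<Lambda> \<subseteq> F <#> \<Lambda>"
    using assms covered_square unfolding covered_def by blast
  have "X <#> \<Lambda> \<subseteq> E <#> (\<Lambda> <#> \<Lambda>)"
    using mono_set_mult[OF E(3) order_refl[of \<Lambda>], of G]
    by (simp only: set_mult_assoc[OF E(2) Lambda_carrier Lambda_carrier])
  also have "\<dots> \<subseteq> (E <#> F) <#> \<Lambda>"
    using mono_set_mult[OF order_refl[of E] F(3), of G]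
    by (simp only: set_mult_assoc[OF E(2) F(2) Lambda_carrier])
  finally show ?thesis
    unfolding covered_def using E F by (meson finite_set_mult set_mult_closed)
qed

lemma covered_fourth_power: "covered ((\<Lambda> <#> \<Lambda>) <#> (\<Lambda> <#> \<Lambda>))"
  using covered_set_mult[OF covered_set_mult[OF covered_square]] Lambda_carrier
  by (simp add: set_mult_assoc set_mult_closed)

text \<open>Commensuration controls the conjugate of \<Lambda>, not of its square. With
  \<Lambda>\<Lambda> \<subseteq> E\<Lambda>, the conjugate of the square lies in the product of the
  conjugates of E and \<Lambda>; the first is finite and the second is contained in some
  F\<Lambda>.\<close>

lemma covered_conj:
  assumes g: "g \<in> \<Gamma>"
  shows "covered ((\<lambda>x. g \<otimes> x \<otimes> inv g) ` (\<Lambda> <#> \<Lambda>))"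
proof -
  obtain E where E: "finite E" "E \<subseteq> carrier G" "\<Lambda> <#> \<Lambda> \<subseteq> E <#> \<Lambda>"
    using covered_square unfolding covered_def by blast
  have "commensurable G ((g <#\<^bsub>G\<^esub> \<Lambda>) #> inv g) \<Lambda>"
    using commensurates g unfolding commensurates_def by (rule bspec)
  then obtain F where F: "finite F" "F \<subseteq> carrier G" "(g <#\<^bsub>G\<^esub> \<Lambda>) #> inv g \<subseteq> F <#> \<Lambda>"
    unfolding commensurable_def by (elim exE conjE)
  let ?c = "\<lambda>x. g \<otimes> x \<otimes> inv g"
  have gc: "g \<in> carrier G"
    using g Gamma_carrier by blast
  have "?c x \<in> (?c ` E <#> F) <#> \<Lambda>" if x: "x \<in> \<Lambda> <#> \<Lambda>" for x
  proof -
    obtain e l where el: "e \<in> E" "l \<in> \<Lambda>" "x = e \<otimes> l"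
      using subsetD[OF E(3) x] by (auto simp: set_mult_def)
    have "?c l \<in> (g <#\<^bsub>G\<^esub> \<Lambda>) #> inv g"
      using el(2) by (auto simp: l_coset_def r_coset_def)
    from subsetD[OF F(3) this] obtain f k where fk: "f \<in> F" "k \<in> \<Lambda>" "?c l = f \<otimes> k"
      by (auto simp: set_mult_def)
    have cl: "e \<in> carrier G" "l \<in> carrier G" "f \<in> carrier G" "k \<in> carrier G"
      using el fk E(2) F(2) Lambda_carrier by auto
    have "?c x = ?c e \<otimes> ?c l"
      using el(3) cl gc by (simp add: m_assoc) (simp add: m_assoc[symmetric])
    also have "\<dots> = (?c e \<otimes> f) \<otimes> k"
      using cl gc by (simp only: fk(3) m_assoc m_closed inv_closed)
    finally show ?thesis
      using el(1) fk(1,2) unfolding set_mult_def by blast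
  qed
  moreover have "?c ` E \<subseteq> carrier G"
    using E(2) gc by auto
  ultimately show ?thesis
    unfolding covered_def using E(1) F(1,2)
    by (intro exI[of _ "?c ` E <#> F"] conjI finite_set_mult set_mult_closed image_subsetI finite_imageI) auto
qed

lemma covered_nhd:
  assumes "covered X"
  obtains N where "openin T N" "\<one> \<in> N" "N \<inter> X \<subseteq> \<Lambda> <#> \<Lambda>"
  using assms nhd_one_Int_finite_translates[OF Hausdorff compact Lambda_set_inv]
  unfolding covered_def by metis

section \<open>The group \<Gamma> and its neighbourhood base at the identity\<close>

text \<open>Traces are taken on the square rather than on \<Lambda> because
  \<open>covered_nhd\<close> places the points of a covered set near \<one> in
  \<Lambda>\<Lambda>.\<close>

definition square_nhds :: "'a set set" where
  "square_nhds = {N \<inter> (\<Lambda> <#> \<Lambda>) |N. openin T N \<and> \<one> \<in> N}"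

lemma square_nhdsI: "openin T N \<Longrightarrow> \<one> \<in> N \<Longrightarrow> N \<inter> (\<Lambda> <#> \<Lambda>) \<in> square_nhds"
  unfolding square_nhds_def by blast

lemma square_nhdsE:
  assumes "A \<in> square_nhds"
  obtains N where "openin T N" "\<one> \<in> N" "A = N \<inter> (\<Lambda> <#> \<Lambda>)"
  using assms unfolding square_nhds_def by blast

text \<open>A fresh record rather than an update of G: the group H sought has type
  \<open>'a monoid\<close>, while G may carry further fields.\<close>

definition Gamma_group :: "'a monoid" where
  "Gamma_group = \<lparr>carrier = \<Gamma>, mult = (\<otimes>), one = \<one>\<rparr>"

lemma Gamma_group_simps [simp]:
  "carrier Gamma_group = \<Gamma>" "x \<otimes>\<^bsub>Gamma_group\<^esub> y = x \<otimes> y" "\<one>\<^bsub>Gamma_group\<^esub> = \<one>"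
  by (simp_all add: Gamma_group_def)

lemma group_Gamma_group: "group Gamma_group"
proof (rule groupI)
  fix x assume "x \<in> carrier Gamma_group"
  then show "\<exists>y\<in>carrier Gamma_group. y \<otimes>\<^bsub>Gamma_group\<^esub> x = \<one>\<^bsub>Gamma_group\<^esub>"
    using Gamma_carrier subgroup.m_inv_closed[OF subgroup]
    by (intro bexI[of _ "inv x"]) auto
qed (use Gamma_carrier subgroup.m_closed[OF subgroup] subgroup.one_closed[OF subgroup] in
    \<open>auto simp: m_assoc subset_iff\<close>)

lemma inv_Gamma_group [simp]: "x \<in> \<Gamma> \<Longrightarrow> inv\<^bsub>Gamma_group\<^esub> x = inv x"
  using Gamma_carrier subgroup.m_inv_closed[OF subgroup]
  by (intro group.inv_equality[OF group_Gamma_group]) auto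

sublocale base: identity_base Gamma_group square_nhds
proof (intro identity_base.intro identity_base_axioms.intro group_Gamma_group)
  show "square_nhds \<noteq> {}"
    using square_nhdsI[OF openin_topspace] by (auto simp: topspace_eq)
next
  fix A assume "A \<in> square_nhds"
  then show "A \<subseteq> carrier Gamma_group" "\<one>\<^bsub>Gamma_group\<^esub> \<in> A"
    using square_Gamma square_one by (auto elim: square_nhdsE)
next
  fix A B assume "A \<in> square_nhds" "B \<in> square_nhds"
  then obtain M N where MN: "openin T M" "\<one> \<in> M" "A = M \<inter> (\<Lambda> <#> \<Lambda>)"
      "openin T N" "\<one> \<in> N" "B = N \<inter> (\<Lambda> <#> \<Lambda>)"
    by (metis square_nhdsE)
  then show "\<exists>C\<in>square_nhds. C \<subseteq> A \<inter> B"
    by (intro bexI[OF _ square_nhdsI[of "M \<inter> N"]]) auto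
next
  fix A assume "A \<in> square_nhds"
  then obtain N where N: "openin T N" "\<one> \<in> N" "A = N \<inter> (\<Lambda> <#> \<Lambda>)"
    by (rule square_nhdsE)
  obtain M where M: "openin T M" "\<one> \<in> M" "M \<inter> ((\<Lambda> <#> \<Lambda>) <#> (\<Lambda> <#> \<Lambda>)) \<subseteq> \<Lambda> <#> \<Lambda>"
    using covered_nhd covered_fourth_power by blast
  \<comment> \<open>A product of two points of the square is a priori only in the fourth power;
    lying in M brings it back into the square, and lying in N then puts it in A.\<close>
  obtain K where K: "openin T K" "\<one> \<in> K" "\<And>x y. x \<in> K \<Longrightarrow> y \<in> K \<Longrightarrow> x \<otimes> y \<in> N \<inter> M"
    using nhd_one_mult[of "N \<inter> M"] N M by auto
  have "x \<otimes> y \<in> A" if x: "x \<in> K \<inter> (\<Lambda> <#> \<Lambda>)" and y: "y \<in> K \<inter> (\<Lambda> <#> \<Lambda>)" for x y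
  proof -
    have "x \<otimes> y \<in> (\<Lambda> <#> \<Lambda>) <#> (\<Lambda> <#> \<Lambda>)"
      using x y unfolding set_mult_def[of _ "\<Lambda> <#> \<Lambda>" "\<Lambda> <#> \<Lambda>"] by blast
    then show ?thesis
      using K(3)[of x y] M(3) N(3) x y by blast
  qed
  then show "\<exists>B\<in>square_nhds. \<forall>x\<in>B. \<forall>y\<in>B. x \<otimes>\<^bsub>Gamma_group\<^esub> y \<in> A"
    by (intro bexI[OF _ square_nhdsI[OF K(1,2)]]) auto
next
  fix A assume "A \<in> square_nhds"
  then obtain N where N: "openin T N" "\<one> \<in> N" "A = N \<inter> (\<Lambda> <#> \<Lambda>)"
    by (rule square_nhdsE)
  \<comment> \<open>The square is closed under inverses, so pulling back N suffices.\<close>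
  let ?M = "{x \<in> topspace T. inv x \<in> N}"
  have "openin T ?M"
    using openin_continuous_map_preimage[OF continuous_inv N(1)] .
  moreover have "\<one> \<in> ?M"
    using N(2) by (simp add: topspace_eq)
  ultimately have "?M \<inter> (\<Lambda> <#> \<Lambda>) \<in> square_nhds"
    by (rule square_nhdsI)
  then show "\<exists>B\<in>square_nhds. \<forall>x\<in>B. inv\<^bsub>Gamma_group\<^esub> x \<in> A"
    by (rule bexI[rotated]) (use N(3) square_Gamma square_inv in \<open>auto simp: subset_iff\<close>)
next
  fix A g assume "A \<in> square_nhds" and "g \<in> carrier Gamma_group"
  then obtain N where N: "openin T N" "\<one> \<in> N" "A = N \<inter> (\<Lambda> <#> \<Lambda>)" and g: "g \<in> \<Gamma>"
    by (auto elim: square_nhdsE)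
  have gc: "g \<in> carrier G"
    using g Gamma_carrier by blast
  obtain M where M: "openin T M" "\<one> \<in> M"
      "M \<inter> ((\<lambda>x. g \<otimes> x \<otimes> inv g) ` (\<Lambda> <#> \<Lambda>)) \<subseteq> \<Lambda> <#> \<Lambda>"
    using covered_nhd covered_conj[OF g] by blast
  \<comment> \<open>As for products: M returns the conjugates to the square, and N is handled by
    continuity of conjugation in T.\<close>
  let ?K = "{x \<in> topspace T. g \<otimes> x \<otimes> inv g \<in> N \<inter> M}"
  have "continuous_map T T (\<lambda>x. g \<otimes> x \<otimes> inv g)"
    using continuous_map_compose[OF continuous_map_mult_left[OF gc]
        continuous_map_mult_right[OF inv_closed[OF gc]]] by (simp add: o_def)
  from openin_continuous_map_preimage[OF this] have "openin T ?K"
    using M(1) N(1) by blast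
  moreover have "\<one> \<in> ?K"
    using M(2) N(2) gc by (simp add: topspace_eq)
  ultimately have "?K \<inter> (\<Lambda> <#> \<Lambda>) \<in> square_nhds"
    by (rule square_nhdsI)
  moreover have "\<forall>x\<in>?K \<inter> (\<Lambda> <#> \<Lambda>). g \<otimes> x \<otimes> inv g \<in> A"
    using M(3) N(3) by blast
  ultimately show "\<exists>B\<in>square_nhds. \<forall>x\<in>B.
      g \<otimes>\<^bsub>Gamma_group\<^esub> x \<otimes>\<^bsub>Gamma_group\<^esub> inv\<^bsub>Gamma_group\<^esub> g \<in> A"
    using g by auto
qed

section \<open>Comparison of the new topology with that of G\<close>

text \<open>Each identity neighbourhood of G contains its trace on the square, so the new topology
  is finer than the one induced on \<Gamma>.\<close>

lemma continuous_map_inclusion: "continuous_map base.base_topology T (\<lambda>x. x)"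
  unfolding continuous_map
proof (intro conjI allI impI)
  show "(\<lambda>x. x) ` topspace base.base_topology \<subseteq> topspace T"
    using Gamma_carrier by (simp add: topspace_eq)
next
  fix U assume U: "openin T U"
  have "\<exists>A\<in>square_nhds. \<forall>a\<in>A. x \<otimes> a \<in> \<Gamma> \<inter> U" if x: "x \<in> \<Gamma>" "x \<in> U" for x
  proof -
    let ?N = "{y \<in> carrier G. x \<otimes> y \<in> U}"
    have xc: "x \<in> carrier G"
      using x Gamma_carrier by blast
    have "?N \<inter> (\<Lambda> <#> \<Lambda>) \<in> square_nhds"
      using openin_mult_left_preimage[OF xc U] xc x(2) by (intro square_nhdsI) auto
    moreover have "\<forall>a\<in>?N \<inter> (\<Lambda> <#> \<Lambda>). x \<otimes> a \<in> \<Gamma> \<inter> U"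
      using square_Gamma subgroup.m_closed[OF subgroup x(1)] by auto
    ultimately show ?thesis
      by blast
  qed
  then show "openin base.base_topology {x \<in> topspace base.base_topology. x \<in> U}"
    unfolding base.openin_base_topology by auto
qed

text \<open>If x and y in the square are close in T, then \<open>inv x \<otimes> y\<close> is near
  \<one> and in the fourth power, hence in the square. So closeness in T gives closeness in the
  finer topology.\<close>

lemma continuous_map_square: "continuous_map (subtopology T (\<Lambda> <#> \<Lambda>)) base.base_topology (\<lambda>x. x)"
  unfolding continuous_map
proof (intro conjI allI impI)
  show "(\<lambda>x. x) ` topspace (subtopology T (\<Lambda> <#> \<Lambda>)) \<subseteq> topspace base.base_topology"
    using square_Gamma by auto
next
  fix U assume U: "openin base.base_topology U"
  \<comment> \<open>The fourth power contains \<open>inv x\<close>\<Lambda>\<Lambda> for every x in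
    the square, so one M serves all x.\<close>
  obtain M where M: "openin T M" "\<one> \<in> M" "M \<inter> ((\<Lambda> <#> \<Lambda>) <#> (\<Lambda> <#> \<Lambda>)) \<subseteq> \<Lambda> <#> \<Lambda>"
    using covered_nhd covered_fourth_power by blast
  show "openin (subtopology T (\<Lambda> <#> \<Lambda>)) {x \<in> topspace (subtopology T (\<Lambda> <#> \<Lambda>)). x \<in> U}"
  proof (subst openin_subopen, intro ballI)
    fix x assume "x \<in> {x \<in> topspace (subtopology T (\<Lambda> <#> \<Lambda>)). x \<in> U}"
    then have x: "x \<in> \<Lambda> <#> \<Lambda>" "x \<in> U" "x \<in> carrier G"
      by (auto simp: topspace_eq)
    obtain N where N: "openin T N" "\<one> \<in> N" "\<forall>a\<in>N \<inter> (\<Lambda> <#> \<Lambda>). x \<otimes> a \<in> U"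
      using U x(2) unfolding base.openin_base_topology by (auto elim: square_nhdsE) (metis square_nhdsE)
    \<comment> \<open>This is the translate x(N \<inter> M).\<close>
    let ?O = "{y \<in> carrier G. inv x \<otimes> y \<in> N \<inter> M}"
    have O: "openin T ?O"
      using N(1) M(1) x(3) by (intro openin_mult_left_preimage) auto
    have "y \<in> U" if y: "y \<in> ?O" "y \<in> \<Lambda> <#> \<Lambda>" for y
    proof -
      have "inv x \<otimes> y \<in> (\<Lambda> <#> \<Lambda>) <#> (\<Lambda> <#> \<Lambda>)"
        using square_inv[OF x(1)] y(2) unfolding set_mult_def[of _ "\<Lambda> <#> \<Lambda>" "\<Lambda> <#> \<Lambda>"] by blast
      then have "x \<otimes> (inv x \<otimes> y) \<in> U"
        using y(1) M(3) N(3) by blast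
      then show ?thesis
        using x(3) y(1) by (simp add: m_assoc[symmetric])
    qed
    moreover have "x \<in> ?O"
      using x(3) N(2) M(2) by simp
    ultimately show "\<exists>W. openin (subtopology T (\<Lambda> <#> \<Lambda>)) W \<and> x \<in> W \<and>
        W \<subseteq> {x \<in> topspace (subtopology T (\<Lambda> <#> \<Lambda>)). x \<in> U}"
      using openin_subtopology_Int2[OF O, of "\<Lambda> <#> \<Lambda>"] x(1) openin_subset[OF O]
      by (intro exI[of _ "(\<Lambda> <#> \<Lambda>) \<inter> ?O"]) auto
  qed
qed

text \<open>The square is compact in T as a product of compact sets, and
  \<open>continuous_map_square\<close> transports this to the new topology.\<close>

lemma compactin_square: "compactin base.base_topology (\<Lambda> <#> \<Lambda>)"
proof -
  have "compactin (subtopology T (\<Lambda> <#> \<Lambda>)) (\<Lambda> <#> \<Lambda>)"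
    using compactin_set_mult[OF compact compact] by (simp add: compactin_subtopology)
  from image_compactin[OF this continuous_map_square] show ?thesis
    by simp
qed

section \<open>The square as a generating identity neighbourhood, and local compactness\<close>

lemma square_nhd:
  obtains U where "openin base.base_topology U" "\<one> \<in> U" "U \<subseteq> \<Lambda> <#> \<Lambda>"
proof -
  \<comment> \<open>With N the whole group, the square itself is a member of the base;
    \<open>base_nhd\<close> then supplies an open set inside it.\<close>
  have A: "carrier G \<inter> (\<Lambda> <#> \<Lambda>) \<in> square_nhds"
    using openin_topspace[of T] by (intro square_nhdsI) (auto simp: topspace_eq)
  have "\<one> \<in> carrier Gamma_group"
    using subgroup.one_closed[OF subgroup] by simp
  from base.base_nhd[OF A this] obtain U where U: "openin base.base_topology U" "\<one> \<in> U"
      "\<And>u. u \<in> U \<Longrightarrow> \<exists>a\<in>carrier G \<inter> (\<Lambda> <#> \<Lambda>). u = \<one> \<otimes> a"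
    by auto
  then show ?thesis
    by (intro that[of U]) auto
qed

lemma symmetric_square: "symmetric_identity_nhd Gamma_group base.base_topology (\<Lambda> <#> \<Lambda>)"
proof -
  have "set_inv\<^bsub>Gamma_group\<^esub> (\<Lambda> <#> \<Lambda>) = (\<lambda>x. inv x) ` (\<Lambda> <#> \<Lambda>)"
    using square_Gamma by (auto simp: SET_INV_def subset_iff)
  also have "\<dots> = \<Lambda> <#> \<Lambda>"
  proof
    show "\<Lambda> <#> \<Lambda> \<subseteq> (\<lambda>x. inv x) ` (\<Lambda> <#> \<Lambda>)"
    proof
      fix x assume x: "x \<in> \<Lambda> <#> \<Lambda>"
      then have "x = inv (inv x)"
        using square_Gamma Gamma_carrier by auto
      then show "x \<in> (\<lambda>x. inv x) ` (\<Lambda> <#> \<Lambda>)"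
        using square_inv[OF x] by (rule image_eqI)
    qed
  qed (use square_inv in auto)
  finally show ?thesis
    unfolding symmetric_identity_nhd_def using square_nhd square_Gamma by (metis Gamma_group_simps(1,3))
qed

lemma locally_compact_group_Gamma_group: "locally_compact_group Gamma_group base.base_topology"
proof -
  interpret top: topological_group Gamma_group base.base_topology
    by (rule base.topological_group_base_topology)
  obtain U where "openin base.base_topology U" "\<one> \<in> U" "U \<subseteq> \<Lambda> <#> \<Lambda>"
    by (rule square_nhd)
  then have "locally_compact_space base.base_topology"
    using top.locally_compact_if_compact_nhd[OF compactin_square] by simp
  \<comment> \<open>Separation pulls back along the injective continuous inclusion.\<close>
  moreover have "Hausdorff_space base.base_topology"
    using Hausdorff_space_injective_preimage[OF Hausdorff continuous_map_inclusion] by simp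
  ultimately show ?thesis
    by unfold_locales
qed

lemma hom_inclusion: "(\<lambda>x. x) \<in> hom Gamma_group G"
  using Gamma_carrier by (auto simp: hom_def)

text \<open>The inclusion identifies the subgroups generated in \<Gamma> and in G. In G the claim
  follows from \<Lambda> \<subseteq> \<Lambda>\<Lambda> \<subseteq> \<Gamma>.\<close>

lemma generate_square:
  assumes "generate G \<Lambda> = \<Gamma>"
  shows "generate Gamma_group (\<Lambda> <#> \<Lambda>) = \<Gamma>"
proof -
  interpret incl: group_hom Gamma_group G "\<lambda>x. x"
    by (intro group_hom.intro group_hom_axioms.intro group_Gamma_group is_group hom_inclusion)
  have eq: "generate Gamma_group (\<Lambda> <#> \<Lambda>) = generate G (\<Lambda> <#> \<Lambda>)"
    using incl.generate_img[of "\<Lambda> <#> \<Lambda>"] square_Gamma by simp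
  have "\<Lambda> \<subseteq> \<Lambda> <#> \<Lambda>"
    using Lambda_one Lambda_carrier by (force simp: set_mult_def)
  then have "\<Gamma> \<subseteq> generate G (\<Lambda> <#> \<Lambda>)"
    using assms mono_generate by metis
  moreover have "generate G (\<Lambda> <#> \<Lambda>) \<subseteq> \<Gamma>"
    using generate_subgroup_incl[OF square_Gamma subgroup] .
  ultimately show ?thesis
    using eq by blast
qed

end

theorem theorem4p1:
  fixes G :: "('a, 'b) monoid_scheme" and T :: "'a topology" and \<Lambda> \<Gamma> :: "'a set"
  assumes "topological_group G T" and "Hausdorff_space T"
    and "approximate_subgroup G \<Lambda>" and "compactin T \<Lambda>"
    and "subgroup \<Gamma> G" and "\<Lambda> \<subseteq> \<Gamma>" and "commensurates G \<Gamma> \<Lambda>"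
  shows "\<exists>(H :: 'a monoid) S \<phi> V.
           locally_compact_group H S \<and>
           \<phi> \<in> hom H G \<and> inj_on \<phi> (carrier H) \<and> continuous_map S T \<phi> \<and>
           symmetric_identity_nhd H S V \<and> compactin S V \<and>
           (generate G \<Lambda> = \<Gamma> \<longrightarrow> generate H V = carrier H) \<and>
           \<phi> ` V = \<Lambda> <#>\<^bsub>G\<^esub> \<Lambda> \<and> \<phi> ` carrier H = \<Gamma>"
proof -
  interpret commensurated_approximate_subgroup G T \<Lambda> \<Gamma>
    using assms by (simp add: commensurated_approximate_subgroup_def
        commensurated_approximate_subgroup_axioms_def)
  show ?thesis
  proof (intro exI conjI)
    \<comment> \<open>These three facts fix the witnesses: H is \<Gamma> with the new topology,
      \<phi> the inclusion and V the square of \<Lambda>.\<close>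
    show "locally_compact_group Gamma_group base.base_topology"
      by (rule locally_compact_group_Gamma_group)
    show "continuous_map base.base_topology T (\<lambda>x. x)"
      by (rule continuous_map_inclusion)
    show "symmetric_identity_nhd Gamma_group base.base_topology (\<Lambda> <#>\<^bsub>G\<^esub> \<Lambda>)"
      by (rule symmetric_square)
  qed (simp_all add: hom_inclusion compactin_square generate_square)
qed

end
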